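(* Let $k\in\mathbb{N}$ (with $k\ge 1$), let $G=(V,E)$ be a finite weighted graph with vertex measure $\mu:V\to(0,\infty)$, and let $s:E^{or}\to S_k^1$ be a signature of $G$. Then $$\frac12\,\lambda_1(\Delta_\mu^s)\;\le\; h_1^s(\mu)\;\le\; 2\sqrt{2\,d_\mu\,\lambda_1(\Delta_\mu^s)} .$$
   Context: $G=(V,E)$ is a finite simple undirected graph; every edge $\{u,v\}\in E$ carries a positive symmetric weight $w_{uv}=w_{vu}$. Write $u\sim v$ if $\{u,v\}\in E$, $d_u=\sum_{v\sim u}w_{uv}$, and $d_\mu=\max_{u\in V} d_u/\mu(u)$. $E^{or}=\{(u,v),(v,u)\mid \{u,v\}\in E\}$ is the set of oriented edges. $\Gamma=S_k^1=\{\xi^j\mid 1\le j\le k\}\subset\mathbb{C}$ with $\xi=e^{2\pi i/k}$ is the group of $k$-th roots of unity. A signature is a map $s:E^{or}\to\Gamma$, $s_{uv}:=s((u,v))$, with $s_{vu}=s_{uv}^{-1}$. The Laplacian $\Delta_\mu^s$ acts on $f:V\to\mathbb{C}$ by $\Delta_\mu^s f(u)=\frac1{\mu(u)}\sum_{v\sim u}w_{uv}(f(u)-s_{uv}f(v))$; it is self-adjoint and non-negative with respect to $\langle f,g\rangle_\mu=\sum_{u}f(u)\overline{g(u)}\mu(u)$, and $\lambda_1(\Delta_\mu^s)$ is its smallest eigenvalue. For nonempty $V_1\subseteq V$ with induced subgraph $(V_1,E_1)$: the frustration index is $\iota^s(V_1)=\min_{\tau:V_1\to\Gamma}\sum_{\{u,v\}\in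 E_1}w_{uv}|\tau(u)-s_{uv}\tau(v)|$ (the summand does not depend on the orientation of the edge); $|E(V_1,V_1^c)|=\sum_{u\in V_1}\sum_{v\in V\setminus V_1,\,v\sim u}w_{uv}$; $\mathrm{vol}_\mu(V_1)=\sum_{u\in V_1}\mu(u)$; and $$\phi_\mu^s(V_1)=\frac{\iota^s(V_1)+|E(V_1,V_1^c)|}{\mathrm{vol}_\mu(V_1)}.$$ The Cheeger constant is $h_1^s(\mu)=\min_{\emptyset\ne V_1\subseteq V}\phi_\mu^s(V_1)$. *)

theory Defs
  imports Complex_Main "HOL-Library.FuncSet"
begin

definition weighted_graph :: "'a set \<Rightarrow> 'a set set \<Rightarrow> ('a \<Rightarrow> 'a \<Rightarrow> real) \<Rightarrow> bool" where
  "weighted_graph V E w \<longleftrightarrow>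
     finite V \<and> V \<noteq> {} \<and>
     (\<forall>e\<in>E. e \<subseteq> V \<and> card e = 2) \<and>
     (\<forall>u v. {u, v} \<in> E \<longrightarrow> w u v > 0 \<and> w u v = w v u)"

definition oriented_edges :: "'a set set \<Rightarrow> ('a \<times> 'a) set" where
  "oriented_edges E = {(u, v). {u, v} \<in> E}"

definition roots_of_unity :: "nat \<Rightarrow> complex set" where
  "roots_of_unity k = (\<lambda>j. exp (2 * of_real pi * \<i> / of_nat k) ^ j) ` {1..k}"

text \<open>Values of \<open>s\<close> off the oriented edges are unconstrained; nothing below depends on them.\<close>

definition signature :: "nat \<Rightarrow> 'a set set \<Rightarrow> ('a \<times> 'a \<Rightarrow> complex) \<Rightarrow> bool" where
  "signature k E s \<longleftrightarrow>
     s \<in> oriented_edges E \<rightarrow> roots_of_unity k \<and>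
     (\<forall>(u, v)\<in>oriented_edges E. s (v, u) = inverse (s (u, v)))"

definition nbrs :: "'a set set \<Rightarrow> 'a \<Rightarrow> 'a set" where
  "nbrs E u = {v. {u, v} \<in> E}"

definition wdegree :: "'a set set \<Rightarrow> ('a \<Rightarrow> 'a \<Rightarrow> real) \<Rightarrow> 'a \<Rightarrow> real" where
  "wdegree E w u = (\<Sum>v\<in>nbrs E u. w u v)"

definition d_max :: "'a set \<Rightarrow> 'a set set \<Rightarrow> ('a \<Rightarrow> 'a \<Rightarrow> real) \<Rightarrow> ('a \<Rightarrow> real) \<Rightarrow> real" where
  "d_max V E w \<mu> = Max ((\<lambda>u. wdegree E w u / \<mu> u) ` V)"

definition laplacian ::
  "'a set set \<Rightarrow> ('a \<Rightarrow> 'a \<Rightarrow> real) \<Rightarrow> ('a \<Rightarrow> real) \<Rightarrow> ('a \<times> 'a \<Rightarrow> complex)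
     \<Rightarrow> ('a \<Rightarrow> complex) \<Rightarrow> 'a \<Rightarrow> complex" where
  "laplacian E w \<mu> s f u =
     (1 / of_real (\<mu> u)) * (\<Sum>v\<in>nbrs E u. of_real (w u v) * (f u - s (u, v) * f v))"

text \<open>A function on \<open>V\<close> is represented by any extension to the whole type: for \<open>u \<in> V\<close>
  the Laplacian only uses values on \<open>V\<close>, and being nonzero is tested on \<open>V\<close>.\<close>

definition laplacian_eigenvalue ::
  "'a set \<Rightarrow> 'a set set \<Rightarrow> ('a \<Rightarrow> 'a \<Rightarrow> real) \<Rightarrow> ('a \<Rightarrow> real) \<Rightarrow> ('a \<times> 'a \<Rightarrow> complex)
     \<Rightarrow> complex \<Rightarrow> bool" where
  "laplacian_eigenvalue V E w \<mu> s c \<longleftrightarrow>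
     (\<exists>f. (\<exists>u\<in>V. f u \<noteq> 0) \<and> (\<forall>u\<in>V. laplacian E w \<mu> s f u = c * f u))"

text \<open>The Laplacian of a signature is self-adjoint for the \<open>\<mu>\<close>-weighted inner product,
  so its eigenvalues are real and no eigenvalue is lost by ranging over the reals.\<close>

definition lambda1 ::
  "'a set \<Rightarrow> 'a set set \<Rightarrow> ('a \<Rightarrow> 'a \<Rightarrow> real) \<Rightarrow> ('a \<Rightarrow> real) \<Rightarrow> ('a \<times> 'a \<Rightarrow> complex) \<Rightarrow> real" where
  "lambda1 V E w \<mu> s = Min {x. laplacian_eigenvalue V E w \<mu> s (complex_of_real x)}"

text \<open>The common value of \<open>F\<close> on both orientations of the edge \<open>e\<close>, for \<open>F\<close> symmetric on \<open>e\<close>.\<close>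

definition edge_value :: "('a \<Rightarrow> 'a \<Rightarrow> real) \<Rightarrow> 'a set \<Rightarrow> real" where
  "edge_value F e = (THE x. \<forall>u v. e = {u, v} \<longrightarrow> x = F u v)"

lemma edge_value_eq:
  assumes "F u v = F v u"
  shows "edge_value F {u, v} = F u v"
  unfolding edge_value_def using assms by (intro the_equality) (auto simp: doubleton_eq_iff)

definition frustration_sum ::
  "'a set set \<Rightarrow> ('a \<Rightarrow> 'a \<Rightarrow> real) \<Rightarrow> ('a \<times> 'a \<Rightarrow> complex) \<Rightarrow> 'a set \<Rightarrow> ('a \<Rightarrow> complex) \<Rightarrow> real" where
  "frustration_sum E w s V1 \<tau> =
     (\<Sum>e\<in>{e\<in>E. e \<subseteq> V1}. edge_value (\<lambda>u v. w u v * cmod (\<tau> u - s (u, v) * \<tau> v)) e)"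

definition frustration_index ::
  "nat \<Rightarrow> 'a set set \<Rightarrow> ('a \<Rightarrow> 'a \<Rightarrow> real) \<Rightarrow> ('a \<times> 'a \<Rightarrow> complex) \<Rightarrow> 'a set \<Rightarrow> real" where
  "frustration_index k E w s V1 =
     Min (frustration_sum E w s V1 ` (V1 \<rightarrow>\<^sub>E roots_of_unity k))"

definition boundary_weight ::
  "'a set \<Rightarrow> 'a set set \<Rightarrow> ('a \<Rightarrow> 'a \<Rightarrow> real) \<Rightarrow> 'a set \<Rightarrow> real" where
  "boundary_weight V E w V1 = (\<Sum>u\<in>V1. \<Sum>v\<in>(V - V1) \<inter> nbrs E u. w u v)"

definition vol :: "('a \<Rightarrow> real) \<Rightarrow> 'a set \<Rightarrow> real" where
  "vol \<mu> V1 = (\<Sum>u\<in>V1. \<mu> u)"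

definition phi ::
  "nat \<Rightarrow> 'a set \<Rightarrow> 'a set set \<Rightarrow> ('a \<Rightarrow> 'a \<Rightarrow> real) \<Rightarrow> ('a \<Rightarrow> real) \<Rightarrow> ('a \<times> 'a \<Rightarrow> complex)
     \<Rightarrow> 'a set \<Rightarrow> real" where
  "phi k V E w \<mu> s V1 =
     (frustration_index k E w s V1 + boundary_weight V E w V1) / vol \<mu> V1"

definition cheeger1 ::
  "nat \<Rightarrow> 'a set \<Rightarrow> 'a set set \<Rightarrow> ('a \<Rightarrow> 'a \<Rightarrow> real) \<Rightarrow> ('a \<Rightarrow> real) \<Rightarrow> ('a \<times> 'a \<Rightarrow> complex)
     \<Rightarrow> real" where
  "cheeger1 k V E w \<mu> s = Min (phi k V E w \<mu> s ` (Pow V - {{}}))"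

lemma root_of_unity_norm:
  assumes "z \<in> roots_of_unity k"
  shows "cmod z = 1"
  using assms by (auto simp: roots_of_unity_def norm_power)

lemma frustration_summand_symmetric:
  assumes "weighted_graph V E w" "signature k E s" "{u, v} \<in> E"
  shows "w u v * cmod (\<tau> u - s (u, v) * \<tau> v) = w v u * cmod (\<tau> v - s (v, u) * \<tau> u)"
proof -
  have uv: "(u, v) \<in> oriented_edges E" using assms(3) by (simp add: oriented_edges_def)
  then have n: "cmod (s (u, v)) = 1" and i: "s (v, u) = inverse (s (u, v))"
    using assms(2) by (auto simp: signature_def intro: root_of_unity_norm)
  have nz: "s (u, v) \<noteq> 0" using n by auto
  have "\<tau> u - s (u, v) * \<tau> v = - s (u, v) * (\<tau> v - s (v, u) * \<tau> u)"
    using nz i by (simp add: algebra_simps)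
  then have "cmod (\<tau> u - s (u, v) * \<tau> v) = cmod (\<tau> v - s (v, u) * \<tau> u)"
    using n by (simp add: norm_mult)
  moreover have "w u v = w v u" using assms(1,3) by (auto simp: weighted_graph_def)
  ultimately show ?thesis by simp
qed

end

theory Submission
  imports Defs "HOL-Analysis.Analysis"
begin

text \<open>
  The lower bound evaluates the Rayleigh quotient on a function that equals an optimal
  \<open>\<tau>\<close> on \<open>V\<^sub>1\<close> and vanishes elsewhere: since \<open>|\<tau>(u) - s\<^sub>u\<^sub>v \<tau>(v)| \<le> 2\<close>, its Dirichlet energy is at
  most \<open>2 (\<iota> + |E(V\<^sub>1, V\<^sub>1\<^sup>c)|)\<close>.

  For the upper bound, an eigenfunction \<open>f\<close> is rounded: values with \<open>|f(u)|\<^sup>2 \<le> r\<close> become \<open>0\<close>, and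
  the remaining phases are rounded down to the grid of \<open>k\<close>-th roots of unity shifted by an offset
  \<open>\<theta>\<close>.  As \<open>sin\<close> is concave on \<open>[0, \<pi>]\<close>, averaging over \<open>\<theta>\<close> does not increase the
  distance of two phases.  Averaging over \<open>r\<close> as well gives
  \<open>h \<parallel>f\<parallel>\<^sup>2 \<le> \<Sum> w\<^sub>u\<^sub>v |f(u) - s\<^sub>u\<^sub>v f(v)| (|f(u)| + |f(v)|)\<close>, and Cauchy-Schwarz concludes.
\<close>

section \<open>Rounding of phases\<close>

text \<open>Angles are measured in steps of \<open>2 * pi / k\<close>: the k-th roots of unity sit
  at the integers, and rounding down to the grid becomes \<open>floor\<close>.\<close>

definition phase :: "nat \<Rightarrow> real \<Rightarrow> complex" where
  "phase k a = cis (2 * pi * a / k)"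

lemma phase_add: "phase k (a + b) = phase k a * phase k b"
  by (simp add: phase_def cis_mult add_divide_distrib distrib_left)

lemma norm_phase [simp]: "cmod (phase k a) = 1"
  by (simp add: phase_def)

lemma exp_power_eq_phase: "exp (2 * of_real pi * \<i> / of_nat k) ^ j = phase k (real j)"
proof -
  have "exp (2 * of_real pi * \<i> / of_nat k) = cis (2 * pi / k)"
    by (simp add: cis_conv_exp mult.commute)
  moreover have "real j * (2 * pi / real k) = 2 * pi * real j / real k" by simp
  ultimately show ?thesis by (simp only: Complex.DeMoivre phase_def)
qed

lemma phase_int_mod:
  assumes "k \<ge> 1"
  shows "phase k (of_int m) = phase k (of_int (m mod int k))"
proof -
  have "2 * pi * real_of_int m / real k
      = 2 * pi * real_of_int (m mod int k) / real k + 2 * pi * real_of_int (m div int k)"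
  proof -
    have "real_of_int m = real_of_int (m mod int k) + real k * real_of_int (m div int k)"
      by (metis mod_mult_div_eq of_int_add of_int_mult of_int_of_nat_eq)
    then show ?thesis using assms by (simp add: field_simps)
  qed
  then show ?thesis
    unfolding phase_def by (simp add: cis_mult[symmetric] cis_multiple_2pi)
qed

lemma phase_int_root:
  assumes "k \<ge> 1"
  shows "phase k (of_int m) \<in> roots_of_unity k"
proof -
  \<comment> \<open>The exponents in \<open>roots_of_unity\<close> run from \<open>1\<close> to
    \<open>k\<close> instead of \<open>0\<close> to \<open>k - 1\<close>; hence \<open>m - 1\<close>
    is reduced modulo \<open>k\<close> and \<open>1\<close> is added back.\<close>
  define j where "j = nat ((m - 1) mod int k) + 1"
  have b: "0 \<le> (m - 1) mod int k" "(m - 1) mod int k < int k" using assms by simp_all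
  have "phase k (of_int m) = phase k (of_int (m - 1)) * phase k 1"
    by (simp flip: phase_add)
  also have "phase k (of_int (m - 1)) = phase k (of_int ((m - 1) mod int k))"
    by (rule phase_int_mod[OF assms])
  also have "\<dots> * phase k 1 = phase k (real j)"
    using b(1) by (simp add: j_def phase_add[symmetric] add.commute)
  finally show ?thesis
    unfolding roots_of_unity_def exp_power_eq_phase using b by (intro image_eqI[of _ _ j]) (auto simp: j_def)
qed

lemma root_eq_phase:
  assumes "z \<in> roots_of_unity k"
  obtains j :: int where "z = phase k (of_int j)"
  using assms unfolding roots_of_unity_def exp_power_eq_phase by (metis imageE of_int_of_nat_eq)

lemma norm_cis_diff: "cmod (cis x - cis y) = 2 * \<bar>sin ((x - y) / 2)\<bar>"
proof -
  have half: "cos (2 * ((x - y) / 2)) = cos (x - y)" by (rule arg_cong[of _ _ cos]) simp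
  have "(cmod (cis x - cis y))\<^sup>2 = (cos x - cos y)\<^sup>2 + (sin x - sin y)\<^sup>2"
    by (simp add: cmod_power2)
  also have "\<dots> = (cos x ^ 2 + sin x ^ 2) + (cos y ^ 2 + sin y ^ 2) - 2 * (cos x * cos y + sin x * sin y)"
    by (simp only: power2_eq_square algebra_simps)
  also have "\<dots> = 2 - 2 * cos (x - y)" by (simp add: cos_diff)
  also have "\<dots> = (2 * \<bar>sin ((x - y) / 2)\<bar>)\<^sup>2"
    using cos_double_sin[of "(x - y) / 2", unfolded half] by (simp add: power_mult_distrib)
  finally show ?thesis by (rule power2_eq_imp_eq) auto
qed

lemma norm_phase_diff: "cmod (phase k a - phase k b) = 2 * \<bar>sin (pi * (a - b) / k)\<bar>"
proof -
  have "(2 * pi * a / k - 2 * pi * b / k) / 2 = pi * (a - b) / k"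
    by (simp add: diff_divide_distrib right_diff_distrib)
  then show ?thesis by (simp add: phase_def norm_cis_diff)
qed

lemma concave_on_sin: "concave_on {0..pi} sin"
  by (rule f''_le0_imp_concave[where f' = cos and f'' = "\<lambda>x. - sin x"])
     (auto intro!: derivative_eq_intros sin_ge_zero)

text \<open>The zeros of \<open>y \<mapsto> sin (\<pi> y / k)\<close> are multiples of \<open>k\<close>, hence integers, so its absolute value is
  concave between consecutive integers.\<close>

lemma abs_sin_chord:
  fixes n :: int and x :: real
  assumes k: "k \<ge> 1" and x: "of_int n \<le> x" "x \<le> of_int n + 1"
  defines "g \<equiv> \<lambda>y. \<bar>sin (pi * y / real k)\<bar>"
  shows "g n + (x - n) * (g (n + 1) - g n) \<le> g x"
proof -
  \<comment> \<open>Since \<open>g\<close> has period \<open>k\<close>, the interval from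
    \<open>n\<close> to \<open>n + 1\<close> can be moved to the one from \<open>m\<close> to
    \<open>m + 1\<close>, which lies between \<open>0\<close> and \<open>k\<close>, where the sine
    is non-negative.\<close>
  define q m where "q = n div int k" and "m = n mod int k"
  have m: "0 \<le> m" "m < int k" using k by (simp_all add: m_def)
  have shift: "g (y + real k * of_int q) = g y" for y
  proof -
    have "pi * (y + real k * of_int q) / real k = pi * y / real k + of_int q * pi"
      using k by (simp add: field_simps)
    moreover have "sin (of_int q * pi) = 0" by (simp add: sin_zero_iff_int2)
    moreover from this have "\<bar>cos (of_int q * pi)\<bar> = 1" by (rule sin_zero_abs_cos_one)
    ultimately show ?thesis by (simp add: g_def sin_add abs_mult)
  qed
  have n: "real_of_int n = of_int m + real k * of_int q"
    unfolding q_def m_def by (metis mod_mult_div_eq of_int_add of_int_mult of_int_of_nat_eq)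
  define t where "t = x - n"
  have t: "0 \<le> t" "t \<le> 1" using x by (auto simp: t_def)
  have range: "pi * y / real k \<in> {0..pi}" if "0 \<le> y" "y \<le> real k" for y
    using that k by (auto simp: field_simps)
  \<comment> \<open>Integrality turns \<open>m < k\<close> into \<open>m + 1 \<le> k\<close>, so the
    right end of the chord also stays in the range of concavity.\<close>
  have "real_of_int (m + 1) \<le> real_of_int (int k)" using m by (simp only: of_int_le_iff)
  then have m': "0 \<le> real_of_int m" "real_of_int m + 1 \<le> real k" using m by simp_all
  have gs: "g y = sin (pi * y / real k)" if "0 \<le> y" "y \<le> real k" for y
    unfolding g_def using range[OF that] by (intro abs_of_nonneg sin_ge_zero) auto
  have "(1 - t) * sin (pi * m / k) + t * sin (pi * (m + 1) / k)
      \<le> sin ((1 - t) *\<^sub>R (pi * m / k) + t *\<^sub>R (pi * (m + 1) / k))"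
    by (rule concave_onD[OF concave_on_sin t]) (use range[of m] range[of "m + 1"] m' in simp_all)
  also have "(1 - t) *\<^sub>R (pi * m / k) + t *\<^sub>R (pi * (m + 1) / k) = pi * (m + t) / k"
    using k by (simp add: field_simps)
  finally have "(1 - t) * g m + t * g (m + 1) \<le> g (m + t)"
    using gs[of m] gs[of "m + 1"] gs[of "m + t"] m' t by simp
  then have "(1 - t) * g n + t * g (n + 1) \<le> g x"
    using shift[of m] shift[of "m + 1"] shift[of "m + t"] n by (simp add: t_def algebra_simps)
  then show ?thesis by (simp add: t_def algebra_simps)
qed

section \<open>Averages over offsets and levels\<close>

text \<open>The integrand jumps once, at \<open>1 - frac a\<close>, from
  \<open>\<lfloor>a\<rfloor>\<close> to the next integer. In probabilistic terms, rounding with a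
  uniform offset is unbiased.\<close>

lemma has_integral_floor_shift:
  fixes a :: real
  shows "((\<lambda>\<theta>. real_of_int \<lfloor>a + \<theta>\<rfloor>) has_integral a) {0..1}"
proof -
  define c where "c = 1 - frac a"
  have c: "0 \<le> c" "c \<le> 1" using frac_ge_0[of a] frac_lt_1[of a] by (auto simp: c_def)
  have 1: "((\<lambda>\<theta>. real_of_int \<lfloor>a + \<theta>\<rfloor>) has_integral (c * \<lfloor>a\<rfloor>)) {0..c}"
  \<comment> \<open>The endpoint \<open>c\<close> already carries the upper value; a single point
    does not affect the integral.\<close>
  proof (rule has_integral_spike_finite[of "{c}"])
    show "((\<lambda>_. real_of_int \<lfloor>a\<rfloor>) has_integral (c * \<lfloor>a\<rfloor>)) {0..c}"
      using has_integral_const_real[of "real_of_int \<lfloor>a\<rfloor>" 0 c] c by simp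
    show "real_of_int \<lfloor>a + \<theta>\<rfloor> = real_of_int \<lfloor>a\<rfloor>" if "\<theta> \<in> {0..c} - {c}" for \<theta>
    proof -
      have "\<lfloor>a + \<theta>\<rfloor> = \<lfloor>a\<rfloor>" using that by (intro floor_unique) (auto simp: c_def frac_def, linarith+)
      then show ?thesis by simp
    qed
  qed simp
  have 2: "((\<lambda>\<theta>. real_of_int \<lfloor>a + \<theta>\<rfloor>) has_integral ((1 - c) * (\<lfloor>a\<rfloor> + 1))) {c..1}"
  proof (rule has_integral_spike_finite[of "{}"])
    show "((\<lambda>_. real_of_int \<lfloor>a\<rfloor> + 1) has_integral ((1 - c) * (\<lfloor>a\<rfloor> + 1))) {c..1}"
      using has_integral_const_real[of "real_of_int \<lfloor>a\<rfloor> + 1" c 1] c by simp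
    show "real_of_int \<lfloor>a + \<theta>\<rfloor> = real_of_int \<lfloor>a\<rfloor> + 1" if "\<theta> \<in> {c..1} - {}" for \<theta>
    proof -
      have "\<lfloor>a + \<theta>\<rfloor> = \<lfloor>a\<rfloor> + 1" using that by (intro floor_unique) (auto simp: c_def frac_def, linarith+)
      then show ?thesis by simp
    qed
  qed simp
  have "c * \<lfloor>a\<rfloor> + (1 - c) * (\<lfloor>a\<rfloor> + 1) = a"
    by (simp add: c_def frac_def algebra_simps)
  then show ?thesis using has_integral_combine[OF c 1 2] by simp
qed

text \<open>The difference of the two floors only takes the values \<open>n\<close> and \<open>n + 1\<close>, and there the norm agrees
  with an affine function, whose integral is its value at the mean difference \<open>a - b\<close>.\<close>

lemma rounded_phase_diff_integral:
  assumes k: "k \<ge> 1"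
  obtains I where "((\<lambda>\<theta>. cmod (phase k \<lfloor>a + \<theta>\<rfloor> - phase k \<lfloor>b + \<theta>\<rfloor>)) has_integral I) {0..1}"
    and "I \<le> cmod (phase k a - phase k b)"
proof -
  define g where "g y = \<bar>sin (pi * y / real k)\<bar>" for y
  define n where "n = \<lfloor>a - b\<rfloor>"
  define c where "c = g (n + 1) - g n"
  have eq: "cmod (phase k \<lfloor>a + \<theta>\<rfloor> - phase k \<lfloor>b + \<theta>\<rfloor>)
      = 2 * (g n + (real_of_int \<lfloor>a + \<theta>\<rfloor> - real_of_int \<lfloor>b + \<theta>\<rfloor> - real_of_int n) * c)" for \<theta>
  proof -
    have "\<lfloor>a + \<theta>\<rfloor> - \<lfloor>b + \<theta>\<rfloor> = n \<or> \<lfloor>a + \<theta>\<rfloor> - \<lfloor>b + \<theta>\<rfloor> = n + 1"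
      unfolding n_def by linarith
    then have "real_of_int \<lfloor>a + \<theta>\<rfloor> - real_of_int \<lfloor>b + \<theta>\<rfloor> = n
        \<or> real_of_int \<lfloor>a + \<theta>\<rfloor> - real_of_int \<lfloor>b + \<theta>\<rfloor> = n + 1"
      by linarith
    then show ?thesis by (auto simp: norm_phase_diff g_def c_def)
  qed
  have "((\<lambda>\<theta>. 2 * (g n + (real_of_int \<lfloor>a + \<theta>\<rfloor> - real_of_int \<lfloor>b + \<theta>\<rfloor> - real_of_int n) * c)) has_integral 2 * (g n + ((a - b) - n) * c)) {0..1}"
  proof -
    have C: "((\<lambda>_. y) has_integral y) {0..1::real}" for y :: real
      using has_integral_const_real[of y 0 1] by simp
    show ?thesis
      by (intro has_integral_mult_right has_integral_mult_left has_integral_add has_integral_diff C has_integral_floor_shift)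
  qed
  then have "((\<lambda>\<theta>. cmod (phase k \<lfloor>a + \<theta>\<rfloor> - phase k \<lfloor>b + \<theta>\<rfloor>)) has_integral 2 * (g n + ((a - b) - n) * c)) {0..1}"
    by (simp only: eq)
  \<comment> \<open>The affine function is the chord of \<open>g\<close> over \<open>n\<close> and
    \<open>n + 1\<close>, so concavity bounds it at \<open>a - b\<close> by the distance of the
    unrounded phases.\<close>
  moreover have "2 * (g n + ((a - b) - n) * c) \<le> cmod (phase k a - phase k b)"
    using abs_sin_chord[OF k, of n "a - b"] by (simp add: norm_phase_diff g_def c_def n_def)
  ultimately show thesis by (rule that)
qed

text \<open>Layer-cake principle: it turns an integral over cut levels back into the squared modulus
  at a vertex. \<open>M\<close> can be any common upper bound of these squares.\<close>

lemma has_integral_threshold: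
  fixes c M :: real
  assumes "0 \<le> c" "c \<le> M"
  shows "((\<lambda>r. if r < c then 1 else 0) has_integral c) {0..M}"
proof -
  have "((\<lambda>r. if r < c then 1 else 0 :: real) has_integral c) {0..c}"
    by (rule has_integral_spike_finite[of "{c}" _ _ "\<lambda>_. 1"])
       (use has_integral_const_real[of "1::real" 0 c] assms in auto)
  moreover have "((\<lambda>r. if r < c then 1 else 0 :: real) has_integral 0) {c..M}"
    by (rule has_integral_is_0) auto
  ultimately show ?thesis using has_integral_combine[OF assms, of _ c 0] by simp
qed

text \<open>With \<open>m = min p q\<close> and \<open>d\<close> the distance of the two vectors,
  the law of cosines and \<open>m * m \<le> p * q\<close> give \<open>m\<^sup>2 * (cmod (x -
  y))\<^sup>2 + (p - q)\<^sup>2 \<le> d\<^sup>2\<close>. Each of the two summands on the left of the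
  claim is then at most \<open>d * (p + q)\<close>, whence the factor 2.\<close>

lemma threshold_bound:
  fixes x y :: complex and p q :: real
  assumes "cmod x = 1" "cmod y = 1" "0 \<le> p" "0 \<le> q"
  shows "min (p\<^sup>2) (q\<^sup>2) * cmod (x - y) + (max (p\<^sup>2) (q\<^sup>2) - min (p\<^sup>2) (q\<^sup>2))
    \<le> 2 * (cmod (of_real p * x - of_real q * y) * (p + q))"
proof -
  define m d where "m = min p q" and "d = cmod (of_real p * x - of_real q * y)"
  have m: "0 \<le> m" "m \<le> p" "m \<le> q" "m * m \<le> p * q" 
    using assms by (auto simp: m_def intro!: mult_mono)
  have sq: "min (p\<^sup>2) (q\<^sup>2) = m * m" "max (p\<^sup>2) (q\<^sup>2) = m * m + \<bar>p - q\<bar> * (p + q)"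
  proof -
    have "p \<le> q \<longleftrightarrow> p\<^sup>2 \<le> q\<^sup>2" using assms by (simp add: power_mono_iff)
    then show "min (p\<^sup>2) (q\<^sup>2) = m * m" "max (p\<^sup>2) (q\<^sup>2) = m * m + \<bar>p - q\<bar> * (p + q)"
      by (auto simp: m_def min_def max_def power2_eq_square algebra_simps)
  qed
  have expand: "(cmod (of_real a * x - of_real b * y))\<^sup>2 = a\<^sup>2 + b\<^sup>2 - 2 * a * b * (x \<bullet> y)" for a b
  proof -
    have "(cmod (of_real a * x - of_real b * y))\<^sup>2 = a\<^sup>2 * (cmod x)\<^sup>2 + b\<^sup>2 * (cmod y)\<^sup>2 - 2 * a * b * (x \<bullet> y)"
      unfolding cmod_power2 inner_complex_def by (simp add: power2_eq_square algebra_simps)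
    then show ?thesis using assms by simp
  qed
  have "x \<bullet> y \<le> 1" using norm_cauchy_schwarz[of x y] assms by simp
  then have "0 \<le> (p * q - m * m) * (1 - x \<bullet> y)" using m by (intro mult_nonneg_nonneg) auto
  moreover have "(cmod (x - y))\<^sup>2 = 2 - 2 * (x \<bullet> y)" using expand[of 1 1] by simp
  moreover have "d\<^sup>2 = p\<^sup>2 + q\<^sup>2 - 2 * p * q * (x \<bullet> y)" unfolding d_def by (rule expand)
  ultimately have "m\<^sup>2 * (cmod (x - y))\<^sup>2 + (p - q)\<^sup>2 \<le> d\<^sup>2"
    by (simp only:) (simp add: power2_eq_square algebra_simps)
  then have "(m * cmod (x - y))\<^sup>2 \<le> d\<^sup>2" "(\<bar>p - q\<bar>)\<^sup>2 \<le> d\<^sup>2"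
    by (simp_all add: power_mult_distrib) (smt (verit) zero_le_power2 mult_nonneg_nonneg)+
  moreover have d0: "d \<ge> 0" by (simp add: d_def)
  ultimately have md: "m * cmod (x - y) \<le> d" and pd: "\<bar>p - q\<bar> \<le> d"
    using power2_le_imp_le by blast+
  have "m * (m * cmod (x - y)) \<le> (p + q) * d"
    using md m assms d0 by (intro mult_mono) auto
  moreover have "\<bar>p - q\<bar> * (p + q) \<le> d * (p + q)"
    using pd assms by (intro mult_right_mono) auto
  ultimately show ?thesis unfolding sq d_def[symmetric] by (simp add: algebra_simps)
qed

section \<open>The least eigenvalue\<close>

text \<open>First-order condition at a minimum: near \<open>e = 0\<close> the linear term dominates,
  whatever the sign of \<open>b\<close>.\<close>

lemma linear_nonneg_quadratic:
  fixes a b :: real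
  assumes "\<And>e. 0 \<le> 2 * e * a + e\<^sup>2 * b"
  shows "a = 0"
proof (rule ccontr)
  assume a: "a \<noteq> 0"
  \<comment> \<open>At \<open>e = - a / c\<close> the quadratic equals
    \<open>(a / c)\<^sup>2 * (b - 2 * c)\<close>; this \<open>c\<close> is positive and large enough
    to make it negative.\<close>
  define c where "c = \<bar>b\<bar> + 1"
  have c: "c > 0" "b < 2 * c" by (auto simp: c_def)
  have "2 * (- a / c) * a + (- a / c)\<^sup>2 * b = (a / c)\<^sup>2 * (b - 2 * c)"
    using c by (simp add: power2_eq_square field_simps)
  also have "\<dots> < 0" using a c by (intro mult_pos_neg) auto
  finally show False using assms[of "- a / c"] by simp
qed

lemma continuous_on_coordinate: "continuous_on S (\<lambda>f :: 'a \<Rightarrow> 'b::topological_space. f u)"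
  by (rule continuous_on_subset[OF continuous_on_product_coordinates]) simp

section \<open>Signed graphs, the Dirichlet form and Green's formula\<close>

locale signed_graph =
  fixes k :: nat and V :: "'a set" and E :: "'a set set"
    and w :: "'a \<Rightarrow> 'a \<Rightarrow> real" and \<mu> :: "'a \<Rightarrow> real" and s :: "'a \<times> 'a \<Rightarrow> complex"
  assumes k_pos: "k \<ge> 1"
    and graph: "weighted_graph V E w"
    and mu_pos: "u \<in> V \<Longrightarrow> \<mu> u > 0"
    and sig: "signature k E s"
begin

abbreviation P :: "('a \<times> 'a) set" where "P \<equiv> oriented_edges E"

lemma finite_V: "finite V" and V_nonempty: "V \<noteq> {}"
  using graph by (auto simp: weighted_graph_def)

lemma mu_nonneg: "u \<in> V \<Longrightarrow> 0 \<le> \<mu> u"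
  using mu_pos by (rule less_imp_le)

lemma edgeD:
  assumes "(u, v) \<in> P"
  shows "u \<in> V" "v \<in> V" "u \<noteq> v" "(v, u) \<in> P" "w u v > 0" "w v u = w u v"
    "cmod (s (u, v)) = 1" "s (v, u) = cnj (s (u, v))" "s (u, v) \<in> roots_of_unity k"
proof -
  have e: "{u, v} \<in> E" using assms by (simp add: oriented_edges_def)
  then have "{u, v} \<subseteq> V" "card {u, v} = 2" using graph by (auto simp: weighted_graph_def)
  then show "u \<in> V" "v \<in> V" "u \<noteq> v" by (auto simp: card_insert_if)
  show "(v, u) \<in> P" using e by (simp add: oriented_edges_def insert_commute)
  have "w u v > 0 \<and> w u v = w v u" using e graph unfolding weighted_graph_def by blast
  then show "w u v > 0" "w v u = w u v" by simp_all
  show root: "s (u, v) \<in> roots_of_unity k" using assms sig by (auto simp: signature_def)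
  then show n: "cmod (s (u, v)) = 1" by (rule root_of_unity_norm)
  have "s (v, u) = inverse (s (u, v))" using assms sig by (auto simp: signature_def)
  with n show "s (v, u) = cnj (s (u, v))" by (simp add: complex_eq_iff power2_eq_square cmod_def)
qed

lemma finite_P: "finite P"
  by (rule finite_subset[of _ "V \<times> V"]) (use edgeD(1,2) finite_V in auto)

lemma sum_P: "(\<Sum>u\<in>V. \<Sum>v\<in>nbrs E u. F u v) = (\<Sum>(u, v)\<in>P. F u v)"
proof -
  have nb: "nbrs E u \<subseteq> V" for u using edgeD(1,2) by (auto simp: nbrs_def oriented_edges_def)
  have P: "P = Sigma V (nbrs E)" using edgeD(1,2) by (auto simp: nbrs_def oriented_edges_def)
  show ?thesis unfolding P
    by (rule sum.Sigma) (auto intro: finite_V finite_subset[OF nb finite_V])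
qed

lemma sum_P_swap: "(\<Sum>(u, v)\<in>P. F u v) = (\<Sum>(u, v)\<in>P. F v u)"
  by (rule sum.reindex_bij_witness[where i = prod.swap and j = prod.swap]) (auto intro: edgeD(4))

definition ip :: "('a \<Rightarrow> complex) \<Rightarrow> ('a \<Rightarrow> complex) \<Rightarrow> complex" where
  "ip f g = (\<Sum>u\<in>V. of_real (\<mu> u) * (f u * cnj (g u)))"

text \<open>The sesquilinear form of the Laplacian; the factor 1/2 compensates for each edge
  occurring in both orientations. Its diagonal is real and is recorded as
  \<open>dirichlet\<close>.\<close>

definition energy :: "('a \<Rightarrow> complex) \<Rightarrow> ('a \<Rightarrow> complex) \<Rightarrow> complex" where
  "energy f g = (1/2) * (\<Sum>(u, v)\<in>P. of_real (w u v) * ((f u - s (u, v) * f v) * cnj (g u - s (u, v) * g v)))"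

definition nrm2 :: "('a \<Rightarrow> complex) \<Rightarrow> real" where
  "nrm2 f = (\<Sum>u\<in>V. \<mu> u * (cmod (f u))\<^sup>2)"

definition dirichlet :: "('a \<Rightarrow> complex) \<Rightarrow> real" where
  "dirichlet f = (\<Sum>(u, v)\<in>P. w u v * (cmod (f u - s (u, v) * f v))\<^sup>2) / 2"

lemma ip_self: "ip f f = of_real (nrm2 f)"
  by (simp add: ip_def nrm2_def complex_norm_square[symmetric])

lemma energy_self: "energy f f = of_real (dirichlet f)"
  unfolding energy_def dirichlet_def case_prod_unfold complex_norm_square[symmetric] by simp

lemma nrm2_pos: "u \<in> V \<Longrightarrow> f u \<noteq> 0 \<Longrightarrow> nrm2 f > 0"
  unfolding nrm2_def
  by (rule sum_pos2[OF finite_V, of u]) (use mu_pos mu_nonneg in auto)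

lemma energy_commute: "energy g f = cnj (energy f g)"
  by (simp add: energy_def case_prod_unfold mult.commute)

lemma ip_commute: "ip g f = cnj (ip f g)"
  by (simp add: ip_def mult.commute)

text \<open>Reversing all edges replaces \<open>f v - s (v, u) * f u\<close> by
  \<open>- cnj (s (u, v)) * (f u - s (u, v) * f v)\<close>, which moves the factor onto
  \<open>g v\<close>. Adding the original and the reversed sum completes the difference
  \<open>g u - s (u, v) * g v\<close> and gives twice the form.\<close>

lemma green: "ip (laplacian E w \<mu> s f) g = energy f g"
proof -
  have "ip (laplacian E w \<mu> s f) g
      = (\<Sum>u\<in>V. \<Sum>v\<in>nbrs E u. of_real (w u v) * (f u - s (u, v) * f v) * cnj (g u))"
    unfolding ip_def laplacian_def
  proof (rule sum.cong[OF refl])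
    fix u assume "u \<in> V"
    then have "\<mu> u \<noteq> 0" using mu_pos by force
    then show "of_real (\<mu> u) * ((1 / of_real (\<mu> u)) * (\<Sum>v\<in>nbrs E u. of_real (w u v) * (f u - s (u, v) * f v)) * cnj (g u))
        = (\<Sum>v\<in>nbrs E u. of_real (w u v) * (f u - s (u, v) * f v) * cnj (g u))"
      by (simp add: sum_distrib_right)
  qed
  also have "\<dots> = (\<Sum>(u, v)\<in>P. of_real (w u v) * (f u - s (u, v) * f v) * cnj (g u))"
    by (rule sum_P)
  finally have 1: "ip (laplacian E w \<mu> s f) g = \<dots>" .
  also have "\<dots> = (\<Sum>(u, v)\<in>P. of_real (w v u) * (f v - s (v, u) * f u) * cnj (g v))"
    by (rule sum_P_swap)
  also have "\<dots> = (\<Sum>(u, v)\<in>P. - (of_real (w u v) * (f u - s (u, v) * f v) * cnj (s (u, v) * g v)))"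
  proof (rule sum.cong[OF refl], clarify)
    fix u v assume uv: "(u, v) \<in> P"
    have "s (u, v) * cnj (s (u, v)) = 1"
      using edgeD(7)[OF uv] by (simp add: complex_norm_square[symmetric])
    then have "f v - s (v, u) * f u = - (cnj (s (u, v)) * (f u - s (u, v) * f v))"
      by (simp add: edgeD(8)[OF uv] algebra_simps)
    then show "of_real (w v u) * (f v - s (v, u) * f u) * cnj (g v)
        = - (of_real (w u v) * (f u - s (u, v) * f v) * cnj (s (u, v) * g v))"
      by (simp add: edgeD(6)[OF uv])
  qed
  finally have 2: "ip (laplacian E w \<mu> s f) g = \<dots>" .
  have "2 * ip (laplacian E w \<mu> s f) g = 2 * energy f g"
    unfolding mult_2[of "ip _ _"]
    by (subst (1) 1, subst 2) (simp add: energy_def sum.distrib[symmetric] case_prod_unfold algebra_simps)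
  then show ?thesis by simp
qed

text \<open>Green's formula tested on \<open>f\<close> itself: an eigenvalue is the Rayleigh
  quotient of its eigenfunction.\<close>

lemma eigenvalue_dirichlet:
  assumes "\<forall>u\<in>V. laplacian E w \<mu> s f u = of_real c * f u"
  shows "dirichlet f = c * nrm2 f"
proof -
  have "complex_of_real (dirichlet f) = ip (laplacian E w \<mu> s f) f" by (simp add: green energy_self)
  also have "\<dots> = of_real c * ip f f"
    using assms by (simp add: ip_def sum_distrib_left algebra_simps)
  finally have "complex_of_real (dirichlet f) = of_real (c * nrm2 f)" by (simp add: ip_self)
  then show ?thesis using of_real_eq_iff by blast
qed

section \<open>Orthogonality and finiteness of the spectrum\<close>

text \<open>Self-adjointness, that is, \<open>green\<close> with the Hermitian symmetry of
  \<open>energy\<close>, gives \<open>a * ip f g = b * ip f g\<close>; conjugation fixes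
  \<open>b\<close> because it is real.\<close>

lemma eigenfunctions_orthogonal:
  assumes "\<forall>u\<in>V. laplacian E w \<mu> s f u = of_real a * f u"
    and "\<forall>u\<in>V. laplacian E w \<mu> s g u = of_real b * g u" and "a \<noteq> b"
  shows "ip f g = 0"
proof -
  have "of_real a * ip f g = energy f g" 
    using assms(1) by (simp add: green[symmetric] ip_def sum_distrib_left algebra_simps)
  also have "\<dots> = cnj (ip (laplacian E w \<mu> s g) f)" by (simp add: green energy_commute[of f])
  also have "\<dots> = of_real b * ip f g"
    using assms(2) by (simp add: ip_def sum_distrib_left algebra_simps)
  finally show ?thesis using assms(3) by simp
qed

text \<open>Bessel's inequality for the indicator of \<open>u\<close> reads \<open>\<Sum>\<^sub>a \<mu>(u) |F\<^sub>a(u)|\<^sup>2 \<le> 1\<close>; summing it over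
  \<open>u\<close> counts the family.\<close>

lemma card_orthonormal:
  assumes T: "finite T" and on: "\<And>a b. a \<in> T \<Longrightarrow> b \<in> T \<Longrightarrow> ip (F a) (F b) = (if a = b then 1 else 0)"
  shows "card T \<le> card V"
proof -
  have bessel: "(\<Sum>a\<in>T. \<mu> u * (cmod (F a u))\<^sup>2) \<le> 1" if u: "u \<in> V" for u
  proof -
    \<comment> \<open>\<open>c a\<close> is the coefficient \<open>ip \<delta> (F a)\<close>, so
      \<open>g\<close> is the orthogonal projection of the indicator \<open>\<delta>\<close> onto
      the span of the family, and \<open>S\<close> is its squared norm.\<close>
    define c where "c a = of_real (\<mu> u) * cnj (F a u)" for a
    define g where "g x = (\<Sum>a\<in>T. c a * F a x)" for x
    define \<delta> where "\<delta> x = (if x = u then 1 else 0 :: complex)" for x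
    define S where "S = (\<Sum>a\<in>T. (cmod (c a))\<^sup>2)"
    have ig: "ip g h = (\<Sum>a\<in>T. c a * ip (F a) h)" for h
      unfolding ip_def g_def sum_distrib_left sum_distrib_right
      by (subst sum.swap) (simp add: algebra_simps)
    have Fd: "ip (F a) \<delta> = cnj (c a)" for a
      using finite_V u by (simp add: ip_def \<delta>_def c_def if_distrib cong: if_cong)
    have gF: "ip g (F a) = c a" if "a \<in> T" for a
      using that T by (simp add: ig on if_distrib cong: if_cong)
    have gd: "ip g \<delta> = of_real S"
      by (simp add: ig Fd S_def complex_norm_square[symmetric])
    have "ip g g = (\<Sum>a\<in>T. c a * cnj (c a))"
      unfolding ig[of g] by (rule sum.cong[OF refl]) (metis gF ip_commute)
    then have gg: "ip g g = of_real S" by (simp add: S_def complex_norm_square[symmetric])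
    have dd: "ip \<delta> \<delta> = of_real (\<mu> u)"
      using finite_V u by (simp add: ip_def \<delta>_def if_distrib cong: if_cong)
    have "ip (\<lambda>x. \<delta> x - g x) (\<lambda>x. \<delta> x - g x) = ip \<delta> \<delta> - ip \<delta> g - ip g \<delta> + ip g g"
      by (simp add: ip_def algebra_simps sum_subtractf sum.distrib)
    also have "\<dots> = of_real (\<mu> u - S)"
      by (simp add: dd gd gg ip_commute[of \<delta> g])
    finally have "nrm2 (\<lambda>x. \<delta> x - g x) = \<mu> u - S"
      unfolding ip_self using of_real_eq_iff by blast
    moreover have "nrm2 h \<ge> 0" for h
      unfolding nrm2_def by (intro sum_nonneg mult_nonneg_nonneg) (auto simp: mu_nonneg)
    ultimately have "S \<le> \<mu> u" by (metis diff_ge_0_iff_ge)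
    moreover have "S = \<mu> u * (\<Sum>a\<in>T. \<mu> u * (cmod (F a u))\<^sup>2)"
      using mu_nonneg[OF u]
      by (simp add: S_def c_def norm_mult power_mult_distrib sum_distrib_left power2_eq_square algebra_simps)
    ultimately show ?thesis using mu_pos[OF u] by simp
  qed
  have "real (card T) = (\<Sum>a\<in>T. nrm2 (F a))"
  proof -
    have "nrm2 (F a) = 1" if "a \<in> T" for a
      using on[OF that that] unfolding ip_self by simp
    then show ?thesis by simp
  qed
  also have "\<dots> = (\<Sum>u\<in>V. \<Sum>a\<in>T. \<mu> u * (cmod (F a u))\<^sup>2)"
    unfolding nrm2_def by (rule sum.swap)
  also have "\<dots> \<le> (\<Sum>u\<in>V. 1)" by (rule sum_mono) (rule bessel)
  finally show ?thesis by simp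
qed

abbreviation spectrum :: "real set" where
  "spectrum \<equiv> {x. laplacian_eigenvalue V E w \<mu> s (complex_of_real x)}"

text \<open>Distinct eigenvalues have orthogonal eigenfunctions, so there are at most
  \<open>card V\<close> of them. This gives the \<open>Min\<close> in \<open>lambda1\<close> its
  intended meaning.\<close>

lemma finite_spectrum: "finite spectrum"
proof (rule ccontr)
  assume "infinite spectrum"
  then obtain T where T: "T \<subseteq> spectrum" "finite T" "card T = Suc (card V)"
    using infinite_arbitrarily_large by blast
  have "\<exists>f. nrm2 f = 1 \<and> (\<forall>u\<in>V. laplacian E w \<mu> s f u = of_real c * f u)" if c: "c \<in> T" for c
  proof -
    obtain f u where f: "u \<in> V" "f u \<noteq> 0" "\<forall>u\<in>V. laplacian E w \<mu> s f u = of_real c * f u"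
      using c T(1) unfolding laplacian_eigenvalue_def by blast
    define r where "r = sqrt (nrm2 f)"
    have r: "r > 0" "r\<^sup>2 = nrm2 f" using nrm2_pos[of u f] f by (auto simp: r_def)
    have "nrm2 (\<lambda>x. f x / of_real r) = nrm2 f / r\<^sup>2"
      by (simp add: nrm2_def norm_divide power_divide sum_divide_distrib)
    then have "nrm2 (\<lambda>x. f x / of_real r) = 1" using r(1) by (simp add: r(2)[symmetric])
    moreover have "laplacian E w \<mu> s (\<lambda>x. f x / of_real r) u = laplacian E w \<mu> s f u / of_real r" for u
      by (simp add: laplacian_def sum_divide_distrib diff_divide_distrib algebra_simps)
    ultimately show ?thesis using f(3) by (intro exI[of _ "\<lambda>x. f x / of_real r"]) simp
  qed
  then obtain F where F: "\<And>c. c \<in> T \<Longrightarrow> nrm2 (F c) = 1"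
      "\<And>c. c \<in> T \<Longrightarrow> \<forall>u\<in>V. laplacian E w \<mu> s (F c) u = of_real c * F c u"
    by metis
  have "card T \<le> card V"
  proof (rule card_orthonormal[OF T(2)])
    fix a b assume "a \<in> T" "b \<in> T"
    then show "ip (F a) (F b) = (if a = b then 1 else 0)"
      using eigenfunctions_orthogonal[of "F a" a "F b" b] F by (auto simp: ip_self)
  qed
  with T(3) show False by simp
qed

section \<open>Variational characterization of the least eigenvalue\<close>

text \<open>Compactness: the unit sphere of \<open>nrm2\<close> is closed in a product of compact
  discs, and the continuous \<open>dirichlet\<close> attains its infimum there.\<close>

lemma rayleigh_minimizer:
  obtains f where "nrm2 f = 1" "\<And>g. dirichlet f * nrm2 g \<le> dirichlet g"
proof -
  \<comment> \<open>Functions live on the whole type; collapsing the factors off \<open>V\<close> to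
    \<open>{0}\<close> keeps the product compact. The radius is the largest modulus at
    \<open>u\<close> that \<open>nrm2 f = 1\<close> permits.\<close>
  define C where "C u = (if u \<in> V then cball (0::complex) (1 / sqrt (\<mu> u)) else {0})" for u
  define K where "K = {f \<in> PiE UNIV C. nrm2 f = 1}"
  have "compactin (product_topology (\<lambda>_. euclidean) UNIV) (PiE UNIV C)"
    unfolding compactin_PiE by (auto simp: C_def)
  then have box: "compact (PiE UNIV C)" by (simp add: euclidean_product_topology)
  have cn: "continuous_on UNIV nrm2" unfolding nrm2_def
    by (intro continuous_intros continuous_on_coordinate)
  have cd: "continuous_on K dirichlet" unfolding dirichlet_def case_prod_unfold
    by (intro continuous_intros continuous_on_coordinate) auto
  have "closed (nrm2 -` {1})" by (rule closed_vimage[OF _ cn]) simp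
  then have "compact (PiE UNIV C \<inter> nrm2 -` {1})" using box by (rule compact_Int_closed[rotated])
  moreover have "K = PiE UNIV C \<inter> nrm2 -` {1}" by (auto simp: K_def)
  ultimately have K: "compact K" by simp
  \<comment> \<open>By homogeneity every \<open>g\<close> of positive norm has a representative in
    \<open>K\<close> with the same Rayleigh quotient; setting it to zero off \<open>V\<close> leaves
    the energy alone, as edges have both ends in \<open>V\<close>.\<close>
  have scale: "\<exists>h\<in>K. dirichlet h * nrm2 g = dirichlet g" if g: "nrm2 g > 0" for g
  proof -
    define r where "r = sqrt (nrm2 g)"
    have r: "r > 0" "r\<^sup>2 = nrm2 g" using g by (auto simp: r_def)
    define h where "h u = (if u \<in> V then g u / of_real r else 0)" for u
    have "nrm2 h = nrm2 g / r\<^sup>2"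
      by (simp add: nrm2_def h_def norm_divide power_divide sum_divide_distrib)
    then have h1: "nrm2 h = 1" using r(1) by (simp add: r(2)[symmetric])
    have "dirichlet h = dirichlet g / r\<^sup>2"
    proof -
      have "w u v * (cmod (h u - s (u, v) * h v))\<^sup>2 = w u v * (cmod (g u - s (u, v) * g v))\<^sup>2 / r\<^sup>2"
        if "(u, v) \<in> P" for u v
      proof -
        have "h u - s (u, v) * h v = (g u - s (u, v) * g v) / of_real r"
          using edgeD[OF that] by (simp add: h_def diff_divide_distrib)
        then show ?thesis by (simp add: norm_divide power_divide)
      qed
      then show ?thesis by (auto simp: dirichlet_def sum_divide_distrib intro!: sum.cong)
    qed
    then have hd: "dirichlet h * nrm2 g = dirichlet g" using r(1) by (simp add: r(2)[symmetric])
    have "h u \<in> C u" for u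
    proof (cases "u \<in> V")
      case True
      have "\<mu> u * (cmod (h u))\<^sup>2 \<le> nrm2 h" unfolding nrm2_def
        by (rule member_le_sum[OF True]) (use mu_nonneg finite_V in auto)
      then have "(cmod (h u))\<^sup>2 \<le> 1 / \<mu> u" using mu_pos[OF True] h1 by (simp add: field_simps)
      then have "cmod (h u) \<le> sqrt (1 / \<mu> u)" by (rule real_le_rsqrt)
      then show ?thesis using True by (simp add: C_def real_sqrt_divide)
    qed (simp add: C_def h_def)
    then show ?thesis using h1 hd by (auto simp: K_def)
  qed
  obtain u0 where "u0 \<in> V" using V_nonempty by blast
  then have "K \<noteq> {}" using scale[OF nrm2_pos[of u0 "\<lambda>_. 1"]] by auto
  then obtain f where f: "f \<in> K" "\<And>h. h \<in> K \<Longrightarrow> dirichlet f \<le> dirichlet h"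
    using continuous_attains_inf[OF K _ cd] by blast
  have nn: "nrm2 g \<ge> 0" "dirichlet g \<ge> 0" for g
    unfolding nrm2_def dirichlet_def
    by (auto intro!: sum_nonneg mult_nonneg_nonneg divide_nonneg_pos mu_nonneg less_imp_le[OF edgeD(5)])
  show ?thesis
  proof
    show "nrm2 f = 1" using f(1) by (simp add: K_def)
    show "dirichlet f * nrm2 g \<le> dirichlet g" for g
    proof (cases "nrm2 g = 0")
      case False
      with nn(1)[of g] have g: "nrm2 g > 0" by linarith
      then obtain h where "h \<in> K" "dirichlet h * nrm2 g = dirichlet g" using scale by blast
      then show ?thesis using f(2)[of h] g by (metis mult_le_cancel_right_pos)
    qed (simp add: nn)
  qed
qed

text \<open>The quadratic form \<open>dirichlet - dirichlet f \<cdot> nrm2\<close> is non-negative and vanishes at \<open>f\<close>; its first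
  variation at \<open>f\<close>, in the direction of the residual \<open>z\<close> placed at \<open>u\<close>, is \<open>2 \<mu>(u) |z|\<^sup>2\<close>.\<close>

lemma energy_minimizer_eigen:
  assumes f: "nrm2 f = 1" "\<And>g. dirichlet f * nrm2 g \<le> dirichlet g" and u: "u \<in> V"
  shows "laplacian E w \<mu> s f u = of_real (dirichlet f) * f u"
proof -
  define c where "c = dirichlet f"
  define z where "z = laplacian E w \<mu> s f u - of_real c * f u"
  define g where "g x = (if x = u then z else 0)" for x
  have "ip f g = of_real (\<mu> u) * (f u * cnj z)"
    and "ip (laplacian E w \<mu> s f) g = of_real (\<mu> u) * (laplacian E w \<mu> s f u * cnj z)"
    using finite_V u by (simp_all add: ip_def g_def if_distrib cong: if_cong)
  then have "energy f g - of_real c * ip f g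
      = of_real (\<mu> u) * ((laplacian E w \<mu> s f u - of_real c * f u) * cnj z)"
    by (simp add: green algebra_simps)
  also have "\<dots> = of_real (\<mu> u) * (z * cnj z)" by (simp only: z_def)
  finally have B: "energy f g - of_real c * ip f g = of_real (\<mu> u * (cmod z)\<^sup>2)"
    by (simp add: complex_norm_square[symmetric])
  \<comment> \<open>Real \<open>e\<close> suffice, since the first-order coefficient
    \<open>B\<close> is already real. The constant term vanishes because \<open>nrm2 f = 1\<close>
    and \<open>c = dirichlet f\<close>.\<close>
  have "0 \<le> 2 * e * (\<mu> u * (cmod z)\<^sup>2) + e\<^sup>2 * (dirichlet g - c * nrm2 g)" for e :: real
  proof -
    define h where "h x = f x + of_real e * g x" for x
    have "energy h h = energy f f + of_real e * (energy f g + energy g f) + of_real e ^ 2 * energy g g"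
      by (simp add: energy_def h_def case_prod_unfold sum.distrib sum_distrib_left algebra_simps power2_eq_square sum_subtractf)
    moreover have "ip h h = ip f f + of_real e * (ip f g + ip g f) + of_real e ^ 2 * ip g g"
      by (simp add: ip_def h_def sum.distrib sum_distrib_left algebra_simps power2_eq_square)
    ultimately have "energy h h - of_real c * ip h h
      = (energy f f - of_real c * ip f f) + of_real e * ((energy f g - of_real c * ip f g) + cnj (energy f g - of_real c * ip f g))
        + of_real e ^ 2 * (energy g g - of_real c * ip g g)"
      by (simp add: energy_commute[of g f] ip_commute[of g f] algebra_simps)
    also have "\<dots> = of_real (2 * e * (\<mu> u * (cmod z)\<^sup>2) + e\<^sup>2 * (dirichlet g - c * nrm2 g))"
      unfolding B by (simp add: energy_self ip_self f(1) c_def algebra_simps)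
    finally have "dirichlet h - c * nrm2 h = 2 * e * (\<mu> u * (cmod z)\<^sup>2) + e\<^sup>2 * (dirichlet g - c * nrm2 g)"
      unfolding energy_self ip_self of_real_mult[symmetric] of_real_diff[symmetric] of_real_eq_iff .
    with f(2)[of h] show ?thesis by (simp add: c_def)
  qed
  then have "\<mu> u * (cmod z)\<^sup>2 = 0" by (rule linear_nonneg_quadratic)
  then show ?thesis using mu_pos[OF u] by (simp add: z_def c_def)
qed

text \<open>The Rayleigh minimizer is an eigenfunction, and every eigenvalue is a Rayleigh quotient,
  so the least eigenvalue is the minimum of the quotient.\<close>

lemma lambda1_le: "lambda1 V E w \<mu> s * nrm2 g \<le> dirichlet g"
  and lambda1_eigenfunction: "\<exists>f. (\<exists>u\<in>V. f u \<noteq> 0) \<and> dirichlet f = lambda1 V E w \<mu> s * nrm2 f"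
proof -
  obtain f where f: "nrm2 f = 1" "\<And>g. dirichlet f * nrm2 g \<le> dirichlet g"
    using rayleigh_minimizer by blast
  have nz: "\<exists>u\<in>V. f u \<noteq> 0"
  proof (rule ccontr)
    assume "\<not> (\<exists>u\<in>V. f u \<noteq> 0)"
    then have "nrm2 f = 0" by (simp add: nrm2_def)
    with f(1) show False by simp
  qed
  then have "dirichlet f \<in> spectrum"
    using energy_minimizer_eigen[OF f] by (auto simp: laplacian_eigenvalue_def)
  moreover have "dirichlet f \<le> x" if x: "x \<in> spectrum" for x
  proof -
    obtain g u where g: "u \<in> V" "g u \<noteq> 0" "\<forall>u\<in>V. laplacian E w \<mu> s g u = of_real x * g u"
      using x unfolding laplacian_eigenvalue_def by blast
    show ?thesis
      using f(2)[of g] eigenvalue_dirichlet[OF g(3)] nrm2_pos[of u g] g(1,2) by simp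
  qed
  ultimately have l: "lambda1 V E w \<mu> s = dirichlet f"
    unfolding lambda1_def by (intro Min_eqI finite_spectrum)
  show "lambda1 V E w \<mu> s * nrm2 g \<le> dirichlet g" unfolding l by (rule f(2))
  show "\<exists>f. (\<exists>u\<in>V. f u \<noteq> 0) \<and> dirichlet f = lambda1 V E w \<mu> s * nrm2 f"
    using nz l f(1) by auto
qed

section \<open>Cut functionals and the lower bound\<close>

text \<open>The first-power analogue of \<open>dirichlet\<close>, a total variation twisted by the
  signature. It serves as the common form of frustration and boundary.\<close>

definition tv :: "('a \<Rightarrow> complex) \<Rightarrow> real" where
  "tv g = (\<Sum>(u, v)\<in>P. w u v * cmod (g u - s (u, v) * g v)) / 2"

lemma tv_nonneg: "tv g \<ge> 0"
  unfolding tv_def by (auto intro!: sum_nonneg mult_nonneg_nonneg less_imp_le[OF edgeD(5)])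

text \<open>Forgetting the orientation is exactly two-to-one, because an edge has distinct ends;
  symmetry of \<open>F\<close> makes both preimages contribute equally.\<close>

lemma sum_edge_value:
  assumes sym: "\<And>u v. (u, v) \<in> P \<Longrightarrow> F u v = F v u"
  shows "(\<Sum>e\<in>{e\<in>E. e \<subseteq> V1}. edge_value F e)
    = (\<Sum>(u, v)\<in>P. if u \<in> V1 \<and> v \<in> V1 then F u v else 0) / 2"
proof -
  define Q where "Q = {p \<in> P. fst p \<in> V1 \<and> snd p \<in> V1}"
  define h where "h p = {fst p, snd p}" for p :: "'a \<times> 'a"
  have fin: "finite Q" using finite_P by (simp add: Q_def)
  have img: "h ` Q = {e\<in>E. e \<subseteq> V1}"
  proof
    show "h ` Q \<subseteq> {e\<in>E. e \<subseteq> V1}" by (auto simp: Q_def h_def oriented_edges_def)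
    show "{e\<in>E. e \<subseteq> V1} \<subseteq> h ` Q"
    proof
      fix e assume e: "e \<in> {e\<in>E. e \<subseteq> V1}"
      then have "card e = 2" using graph by (simp add: weighted_graph_def)
      then obtain a b where "e = {a, b}" by (auto simp: card_2_iff)
      with e show "e \<in> h ` Q"
        by (intro image_eqI[of _ _ "(a, b)"]) (auto simp: Q_def h_def oriented_edges_def)
    qed
  qed
  have fibre: "(\<Sum>p\<in>{p\<in>Q. h p = e}. F (fst p) (snd p)) = 2 * edge_value F e" if e: "e \<in> h ` Q" for e
  proof -
    obtain a b where "(a, b) \<in> Q" "e = h (a, b)" using e by auto
    then have ab: "(a, b) \<in> Q" "e = {a, b}" by (simp_all add: h_def)
    then have P: "(a, b) \<in> P" by (simp add: Q_def)
    have "{p\<in>Q. h p = e} = {(a, b), (b, a)}"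
      using ab edgeD(4)[OF P] by (auto simp: Q_def h_def doubleton_eq_iff)
    then show ?thesis
      using edgeD(3)[OF P] sym[OF P] by (simp add: ab(2) edge_value_eq)
  qed
  have "(\<Sum>(u, v)\<in>P. if u \<in> V1 \<and> v \<in> V1 then F u v else 0) = (\<Sum>p\<in>Q. F (fst p) (snd p))"
    unfolding Q_def case_prod_unfold by (rule sum.inter_filter[OF finite_P, symmetric])
  also have "\<dots> = (\<Sum>e\<in>h ` Q. \<Sum>p\<in>{p\<in>Q. h p = e}. F (fst p) (snd p))"
    by (rule sum.image_gen[OF fin])
  also have "\<dots> = 2 * (\<Sum>e\<in>{e\<in>E. e \<subseteq> V1}. edge_value F e)"
    unfolding sum_distrib_left img[symmetric] by (rule sum.cong[OF refl fibre])
  finally show ?thesis by simp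
qed

lemma boundary_weight_sum:
  assumes "V1 \<subseteq> V"
  shows "boundary_weight V E w V1 = (\<Sum>(u, v)\<in>P. if u \<in> V1 \<and> v \<notin> V1 then w u v else 0)"
proof -
  have nb: "nbrs E u \<subseteq> V" for u using edgeD(1,2) by (auto simp: nbrs_def oriented_edges_def)
  have "boundary_weight V E w V1
      = (\<Sum>u\<in>V1. \<Sum>v\<in>nbrs E u. if u \<in> V1 \<and> v \<notin> V1 then w u v else 0)"
    unfolding boundary_weight_def
  proof (rule sum.cong[OF refl])
    fix u assume u: "u \<in> V1"
    have "(V - V1) \<inter> nbrs E u = {v \<in> nbrs E u. u \<in> V1 \<and> v \<notin> V1}" using nb u by auto
    then show "(\<Sum>v\<in>(V - V1) \<inter> nbrs E u. w u v)
        = (\<Sum>v\<in>nbrs E u. if u \<in> V1 \<and> v \<notin> V1 then w u v else 0)"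
      using sum.inter_filter[OF finite_subset[OF nb finite_V]] by simp
  qed
  also have "\<dots> = (\<Sum>u\<in>V. \<Sum>v\<in>nbrs E u. if u \<in> V1 \<and> v \<notin> V1 then w u v else 0)"
    by (rule sum.mono_neutral_left) (use assms finite_V in auto)
  also have "\<dots> = (\<Sum>(u, v)\<in>P. if u \<in> V1 \<and> v \<notin> V1 then w u v else 0)" by (rule sum_P)
  finally show ?thesis .
qed

text \<open>After extension by zero, a boundary edge keeps only one end, of modulus 1, and so
  contributes exactly its weight; edges inside \<open>V1\<close> give the frustration terms.\<close>

lemma tv_eq_frustration_plus_boundary:
  assumes V1: "V1 \<subseteq> V" and \<tau>: "\<And>u. u \<in> V1 \<Longrightarrow> cmod (\<tau> u) = 1"
  shows "tv (\<lambda>u. if u \<in> V1 then \<tau> u else 0)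
    = frustration_sum E w s V1 \<tau> + boundary_weight V E w V1"
proof -
  define F where "F u v = w u v * cmod (\<tau> u - s (u, v) * \<tau> v)" for u v
  define B where "B u v = (if u \<in> V1 \<and> v \<notin> V1 then w u v else 0)" for u v
  let ?g = "\<lambda>u. if u \<in> V1 then \<tau> u else 0"
  have "2 * tv ?g = (\<Sum>(u, v)\<in>P. w u v * cmod (?g u - s (u, v) * ?g v))" by (simp add: tv_def)
  also have "\<dots> = (\<Sum>(u, v)\<in>P. (if u \<in> V1 \<and> v \<in> V1 then F u v else 0) + (B u v + B v u))"
  proof (rule sum.cong[OF refl], clarify)
    fix u v assume "(u, v) \<in> P"
    from edgeD(6,7)[OF this]
    show "w u v * cmod (?g u - s (u, v) * ?g v)
        = (if u \<in> V1 \<and> v \<in> V1 then F u v else 0) + (B u v + B v u)"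
      by (auto simp: F_def B_def norm_mult \<tau>)
  qed
  also have "\<dots> = (\<Sum>(u, v)\<in>P. if u \<in> V1 \<and> v \<in> V1 then F u v else 0)
      + ((\<Sum>(u, v)\<in>P. B u v) + (\<Sum>(u, v)\<in>P. B v u))"
    by (simp add: sum.distrib case_prod_unfold)
  also have "(\<Sum>(u, v)\<in>P. B v u) = (\<Sum>(u, v)\<in>P. B u v)" by (rule sum_P_swap)
  also have "(\<Sum>(u, v)\<in>P. B u v) = boundary_weight V E w V1"
    unfolding B_def by (rule boundary_weight_sum[OF V1, symmetric])
  also have "(\<Sum>(u, v)\<in>P. if u \<in> V1 \<and> v \<in> V1 then F u v else 0) = 2 * frustration_sum E w s V1 \<tau>"
  proof -
    have "F u v = F v u" if "(u, v) \<in> P" for u v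
      using frustration_summand_symmetric[OF graph sig, of u v \<tau>] that
      by (simp add: F_def oriented_edges_def)
    from sum_edge_value[of F V1, OF this] show ?thesis
      unfolding frustration_sum_def F_def by simp
  qed
  finally show ?thesis by simp
qed

section \<open>Test functions for the lower bound\<close>

text \<open>Each difference has modulus at most 2, so its square is at most twice its modulus. This
  is the source of the factor 1/2 in the lower bound.\<close>

lemma dirichlet_le_tv:
  assumes "\<And>u. cmod (g u) \<le> 1"
  shows "dirichlet g \<le> 2 * tv g"
proof -
  have "w u v * (cmod (g u - s (u, v) * g v))\<^sup>2 \<le> 2 * (w u v * cmod (g u - s (u, v) * g v))"
    if "(u, v) \<in> P" for u v
  proof -
    have "cmod (g u - s (u, v) * g v) \<le> cmod (g u) + cmod (s (u, v) * g v)" by (rule norm_triangle_ineq4)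
    also have "\<dots> \<le> 2" using assms[of u] assms[of v] edgeD(7)[OF that] by (simp add: norm_mult)
    finally have "cmod (g u - s (u, v) * g v) * cmod (g u - s (u, v) * g v) \<le> 2 * cmod (g u - s (u, v) * g v)"
      by (rule mult_right_mono) simp
    from mult_left_mono[OF this, of "w u v"] edgeD(5)[OF that] show ?thesis
      by (simp add: power2_eq_square)
  qed
  then have "(\<Sum>(u, v)\<in>P. w u v * (cmod (g u - s (u, v) * g v))\<^sup>2)
      \<le> (\<Sum>(u, v)\<in>P. 2 * (w u v * cmod (g u - s (u, v) * g v)))"
    by (intro sum_mono) auto
  then show ?thesis by (simp add: dirichlet_def tv_def sum_distrib_left[symmetric] case_prod_unfold)
qed

lemma finite_sections: "V1 \<subseteq> V \<Longrightarrow> finite (V1 \<rightarrow>\<^sub>E roots_of_unity k)"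
  by (rule finite_PiE) (auto simp: roots_of_unity_def intro: finite_subset[OF _ finite_V])

lemma vol_pos: "V1 \<subseteq> V \<Longrightarrow> V1 \<noteq> {} \<Longrightarrow> vol \<mu> V1 > 0"
  unfolding vol_def by (rule sum_pos) (auto intro: mu_pos finite_subset[OF _ finite_V])

lemma phi_lower:
  assumes V1: "V1 \<subseteq> V" "V1 \<noteq> {}"
  shows "lambda1 V E w \<mu> s / 2 \<le> phi k V E w \<mu> s V1"
proof -
  \<comment> \<open>A witness that the set of candidates \<open>\<tau>\<close> is non-empty, so that
    the minimum in \<open>frustration_index\<close> is attained.\<close>
  have "exp (2 * of_real pi * \<i> / of_nat k) ^ 1 \<in> roots_of_unity k"
    unfolding roots_of_unity_def using k_pos by (intro imageI) simp
  then have "V1 \<rightarrow>\<^sub>E roots_of_unity k \<noteq> {}" by (auto simp: PiE_eq_empty_iff)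
  then have "frustration_index k E w s V1 \<in> frustration_sum E w s V1 ` (V1 \<rightarrow>\<^sub>E roots_of_unity k)"
    unfolding frustration_index_def using finite_sections[OF V1(1)] by (intro Min_in) auto
  then obtain \<tau> where \<tau>: "\<tau> \<in> V1 \<rightarrow>\<^sub>E roots_of_unity k"
      "frustration_index k E w s V1 = frustration_sum E w s V1 \<tau>" by auto
  have n: "cmod (\<tau> u) = 1" if "u \<in> V1" for u
    using \<tau>(1) that by (intro root_of_unity_norm) auto
  define g where "g u = (if u \<in> V1 then \<tau> u else 0)" for u
  have "nrm2 g = (\<Sum>u\<in>V. if u \<in> V1 then \<mu> u else 0)"
    unfolding nrm2_def by (rule sum.cong) (auto simp: g_def n)
  also have "\<dots> = vol \<mu> V1"
    unfolding vol_def using V1(1) finite_V by (simp add: sum.inter_restrict[symmetric] Int_absorb1)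
  finally have N: "nrm2 g = vol \<mu> V1" .
  have "lambda1 V E w \<mu> s * vol \<mu> V1 \<le> dirichlet g" using lambda1_le[of g] by (simp add: N)
  also have "\<dots> \<le> 2 * tv g" by (rule dirichlet_le_tv) (simp add: g_def n)
  also have "tv g = phi k V E w \<mu> s V1 * vol \<mu> V1"
    using tv_eq_frustration_plus_boundary[of V1 \<tau>, OF V1(1) n] vol_pos[OF V1]
    by (simp add: g_def[abs_def] \<tau>(2) phi_def)
  finally show ?thesis using vol_pos[OF V1] by simp
qed

lemma cheeger_ge_half_lambda1: "lambda1 V E w \<mu> s / 2 \<le> cheeger1 k V E w \<mu> s"
proof -
  have "cheeger1 k V E w \<mu> s \<in> phi k V E w \<mu> s ` (Pow V - {{}})"
    unfolding cheeger1_def using finite_V V_nonempty by (intro Min_in) auto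
  then obtain V1 where "V1 \<subseteq> V" "V1 \<noteq> {}" "cheeger1 k V E w \<mu> s = phi k V E w \<mu> s V1" by auto
  then show ?thesis using phi_lower by simp
qed

text \<open>Multiplying by the volume admits the empty set, which occurs as a level set for large
  thresholds.\<close>

lemma cheeger_le_tv:
  assumes V1: "V1 \<subseteq> V" and \<tau>: "\<And>u. u \<in> V1 \<Longrightarrow> \<tau> u \<in> roots_of_unity k"
  shows "cheeger1 k V E w \<mu> s * vol \<mu> V1 \<le> tv (\<lambda>u. if u \<in> V1 then \<tau> u else 0)"
proof (cases "V1 = {}")
  case True
  then show ?thesis by (simp add: vol_def tv_nonneg)
next
  case False
  \<comment> \<open>\<open>frustration_index\<close> ranges over extensional functions, hence the
    restriction.\<close>
  define \<sigma> where "\<sigma> = restrict \<tau> V1"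
  have \<sigma>: "\<sigma> \<in> V1 \<rightarrow>\<^sub>E roots_of_unity k" using \<tau> by (auto simp: \<sigma>_def)
  have "cheeger1 k V E w \<mu> s \<le> phi k V E w \<mu> s V1"
    unfolding cheeger1_def using V1 False finite_V by (intro Min_le) auto
  also have "\<dots> \<le> (frustration_sum E w s V1 \<sigma> + boundary_weight V E w V1) / vol \<mu> V1"
    unfolding phi_def frustration_index_def
    using \<sigma> finite_sections[OF V1] vol_pos[OF V1 False] by (intro divide_right_mono add_right_mono Min_le) auto
  also have "frustration_sum E w s V1 \<sigma> + boundary_weight V E w V1 = tv (\<lambda>u. if u \<in> V1 then \<sigma> u else 0)"
    using \<sigma> by (intro tv_eq_frustration_plus_boundary[symmetric] V1 root_of_unity_norm) auto
  also have "(\<lambda>u. if u \<in> V1 then \<sigma> u else 0) = (\<lambda>u. if u \<in> V1 then \<tau> u else 0)"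
    by (auto simp: \<sigma>_def)
  finally show ?thesis using vol_pos[OF V1 False] by (simp add: field_simps)
qed

section \<open>The upper bound\<close>

text \<open>The offset enters only before \<open>floor\<close>, so the non-zero values are genuine
  k-th roots of unity. The factor \<open>k / (2 * pi)\<close> converts the argument into the units
  of \<open>phase\<close>.\<close>

definition round_fun :: "('a \<Rightarrow> complex) \<Rightarrow> real \<Rightarrow> real \<Rightarrow> 'a \<Rightarrow> complex" where
  "round_fun f r \<theta> u =
     (if r < (cmod (f u))\<^sup>2 then phase k \<lfloor>real k * Arg (f u) / (2 * pi) + \<theta>\<rfloor> else 0)"

lemma polar_phase: "f u = of_real (cmod (f u)) * phase k (real k * Arg (f u) / (2 * pi))"
proof -
  have "2 * pi * (real k * Arg (f u) / (2 * pi)) / real k = Arg (f u)" using k_pos by simp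
  then have "phase k (real k * Arg (f u) / (2 * pi)) = cis (Arg (f u))" by (simp add: phase_def)
  then show ?thesis by (metis rcis_cmod_Arg rcis_def)
qed

text \<open>Here \<open>\<delta>\<close> is the distance of the unrounded phases. Below both squares
  the edge is inside the level set and contributes at most \<open>\<delta>\<close> on average;
  between them it is cut and contributes 1; above both it contributes 0. As \<open>\<delta>\<close>
  is independent of \<open>r\<close>, the bound can be integrated over \<open>r\<close>
  afterwards.\<close>

lemma round_fun_edge_integral:
  fixes f :: "'a \<Rightarrow> complex"
  assumes uv: "(u, v) \<in> P"
  defines "p \<equiv> cmod (f u)" and "q \<equiv> cmod (f v)"
  obtains \<delta> where
    "min (p\<^sup>2) (q\<^sup>2) * \<delta> + (max (p\<^sup>2) (q\<^sup>2) - min (p\<^sup>2) (q\<^sup>2))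
       \<le> 2 * (cmod (f u - s (u, v) * f v) * (p + q))" and
    "\<And>r. \<exists>I. ((\<lambda>\<theta>. cmod (round_fun f r \<theta> u - s (u, v) * round_fun f r \<theta> v)) has_integral I) {0..1}
       \<and> I \<le> (if r < min (p\<^sup>2) (q\<^sup>2) then 1 else 0) * \<delta>
           + ((if r < max (p\<^sup>2) (q\<^sup>2) then 1 else 0) - (if r < min (p\<^sup>2) (q\<^sup>2) then 1 else 0))"
proof -
  define a b where "a = real k * Arg (f u) / (2 * pi)" and "b = real k * Arg (f v) / (2 * pi)"
  obtain j where j: "s (u, v) = phase k (of_int j)" using root_eq_phase[OF edgeD(9)[OF uv]] .
  define \<delta> where "\<delta> = cmod (phase k a - phase k (b + j))"
  have C: "((\<lambda>_. y) has_integral y) {0..1::real}" for y :: real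
    using has_integral_const_real[of y 0 1] by simp
  show ?thesis
  proof
    have "f u = of_real p * phase k a" "s (u, v) * f v = of_real q * phase k (b + j)"
      using polar_phase[of f u] polar_phase[of f v] by (simp_all add: p_def q_def a_def b_def j phase_add mult_ac)
    then show "min (p\<^sup>2) (q\<^sup>2) * \<delta> + (max (p\<^sup>2) (q\<^sup>2) - min (p\<^sup>2) (q\<^sup>2))
        \<le> 2 * (cmod (f u - s (u, v) * f v) * (p + q))"
      using threshold_bound[of "phase k a" "phase k (b + j)" p q] by (simp add: \<delta>_def p_def q_def)
  next
    fix r :: real
    consider "r < p\<^sup>2" "r < q\<^sup>2" | "r < p\<^sup>2" "\<not> r < q\<^sup>2" | "\<not> r < p\<^sup>2" "r < q\<^sup>2"
      | "\<not> r < p\<^sup>2" "\<not> r < q\<^sup>2" by blast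
    then show "\<exists>I. ((\<lambda>\<theta>. cmod (round_fun f r \<theta> u - s (u, v) * round_fun f r \<theta> v)) has_integral I) {0..1}
       \<and> I \<le> (if r < min (p\<^sup>2) (q\<^sup>2) then 1 else 0) * \<delta>
           + ((if r < max (p\<^sup>2) (q\<^sup>2) then 1 else 0) - (if r < min (p\<^sup>2) (q\<^sup>2) then 1 else 0))"
    proof cases
      case 1
      have "round_fun f r \<theta> u - s (u, v) * round_fun f r \<theta> v
          = phase k \<lfloor>a + \<theta>\<rfloor> - phase k \<lfloor>(b + j) + \<theta>\<rfloor>" for \<theta>
      proof -
        \<comment> \<open>Multiplication by \<open>s (u, v)\<close> is a shift by an integer and so
          commutes with \<open>floor\<close>; this is where the values of \<open>s\<close> being
          k-th roots of unity enters.\<close>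
        have "\<lfloor>(b + j) + \<theta>\<rfloor> = \<lfloor>b + \<theta>\<rfloor> + j" by linarith
        then show ?thesis
          using 1 by (simp add: round_fun_def p_def q_def a_def b_def j phase_add)
      qed
      moreover obtain I where "((\<lambda>\<theta>. cmod (phase k \<lfloor>a + \<theta>\<rfloor> - phase k \<lfloor>(b + j) + \<theta>\<rfloor>)) has_integral I) {0..1}"
        "I \<le> \<delta>" using rounded_phase_diff_integral[OF k_pos] unfolding \<delta>_def by blast
      ultimately show ?thesis using 1 by auto
    next
      case 2
      then have "(\<lambda>\<theta>. cmod (round_fun f r \<theta> u - s (u, v) * round_fun f r \<theta> v)) = (\<lambda>_. 1)"
        by (simp add: round_fun_def p_def q_def)
      then show ?thesis using 2 C[of 1] by (intro exI[of _ 1]) auto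
    next
      case 3
      then have "(\<lambda>\<theta>. cmod (round_fun f r \<theta> u - s (u, v) * round_fun f r \<theta> v)) = (\<lambda>_. 1)"
        using edgeD(7)[OF uv] by (simp add: round_fun_def p_def q_def norm_mult)
      then show ?thesis using 3 C[of 1] by (intro exI[of _ 1]) auto
    next
      case 4
      then have "(\<lambda>\<theta>. cmod (round_fun f r \<theta> u - s (u, v) * round_fun f r \<theta> v)) = (\<lambda>_. 0)"
        by (simp add: round_fun_def p_def q_def)
      then show ?thesis using 4 C[of 0] by (intro exI[of _ 0]) auto
    qed
  qed
qed

text \<open>For each level and offset the rounded \<open>f\<close> is admissible in
  \<open>cheeger_le_tv\<close>. Averaging over the offset and then integrating over the level
  produces the squared norm on the left and the edge bounds of
  \<open>round_fun_edge_integral\<close> on the right.\<close>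

lemma cheeger_coarea:
  "cheeger1 k V E w \<mu> s * nrm2 f
    \<le> (\<Sum>(u, v)\<in>P. w u v * (cmod (f u - s (u, v) * f v) * (cmod (f u) + cmod (f v))))"
proof -
  let ?h = "cheeger1 k V E w \<mu> s"
  define p where "p u = (cmod (f u))\<^sup>2" for u
  define lo where "lo e = min (p (fst e)) (p (snd e))" for e
  define hi where "hi e = max (p (fst e)) (p (snd e))" for e
  define W where "W e = w (fst e) (snd e)" for e
  define Y where "Y r \<theta> e = cmod (round_fun f r \<theta> (fst e) - s e * round_fun f r \<theta> (snd e))" for r \<theta> e
  define R where "R e = cmod (f (fst e) - s e * f (snd e)) * (cmod (f (fst e)) + cmod (f (snd e)))" for e
  define T where "T c r = (if r < c then 1 else 0 :: real)" for c r :: real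
  have "\<forall>e\<in>P. \<exists>\<delta>. lo e * \<delta> + (hi e - lo e) \<le> 2 * R e
      \<and> (\<forall>r. \<exists>I. ((\<lambda>\<theta>. Y r \<theta> e) has_integral I) {0..1}
          \<and> I \<le> T (lo e) r * \<delta> + (T (hi e) r - T (lo e) r))"
  proof clarify
    fix u v assume uv: "(u, v) \<in> P"
    show "\<exists>\<delta>. lo (u, v) * \<delta> + (hi (u, v) - lo (u, v)) \<le> 2 * R (u, v)
      \<and> (\<forall>r. \<exists>I. ((\<lambda>\<theta>. Y r \<theta> (u, v)) has_integral I) {0..1}
          \<and> I \<le> T (lo (u, v)) r * \<delta> + (T (hi (u, v)) r - T (lo (u, v)) r))"
      unfolding lo_def hi_def R_def Y_def T_def p_def fst_conv snd_conv
      by (rule round_fun_edge_integral[OF uv, of f]) blast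
  qed
  then obtain \<delta> where \<delta>: "\<And>e. e \<in> P \<Longrightarrow> lo e * \<delta> e + (hi e - lo e) \<le> 2 * R e"
      "\<And>e r. e \<in> P \<Longrightarrow> \<exists>I. ((\<lambda>\<theta>. Y r \<theta> e) has_integral I) {0..1}
          \<and> I \<le> T (lo e) r * \<delta> e + (T (hi e) r - T (lo e) r)"
    by metis
  have W: "W e > 0" if "e \<in> P" for e
    using edgeD(5)[of "fst e" "snd e"] that by (simp add: W_def)
  have level: "?h * (\<Sum>u\<in>V. \<mu> u * T (p u) r)
      \<le> (\<Sum>e\<in>P. W e * (T (lo e) r * \<delta> e + (T (hi e) r - T (lo e) r))) / 2" for r
  proof -
    define V1 where "V1 = {u\<in>V. r < p u}"
    have "(\<Sum>u\<in>V. \<mu> u * T (p u) r) = (\<Sum>u\<in>V. if r < p u then \<mu> u else 0)"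
      by (rule sum.cong) (auto simp: T_def)
    also have "\<dots> = vol \<mu> V1" unfolding vol_def V1_def by (rule sum.inter_filter[OF finite_V, symmetric])
    finally have vol: "(\<Sum>u\<in>V. \<mu> u * T (p u) r) = vol \<mu> V1" .
    \<comment> \<open>The level set does not depend on the offset, so the left side stays constant
      under the average over \<open>\<theta>\<close>.\<close>
    have pt: "?h * vol \<mu> V1 \<le> (\<Sum>e\<in>P. W e * Y r \<theta> e) / 2" for \<theta>
    proof -
      define g where "g u = (if u \<in> V1 then round_fun f r \<theta> u else 0)" for u
      have "?h * vol \<mu> V1 \<le> tv g" unfolding g_def
        by (rule cheeger_le_tv) (auto simp: V1_def p_def round_fun_def intro: phase_int_root[OF k_pos])
      also have "tv g = (\<Sum>e\<in>P. W e * Y r \<theta> e) / 2"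
      proof -
        have "g u = round_fun f r \<theta> u" if "u \<in> V" for u
          using that by (auto simp: g_def V1_def p_def round_fun_def)
        then have "w u v * cmod (g u - s (u, v) * g v) = W (u, v) * Y r \<theta> (u, v)" if "(u, v) \<in> P" for u v
          using edgeD(1,2)[OF that] by (simp add: W_def Y_def)
        then show ?thesis unfolding tv_def by (auto intro!: sum.cong)
      qed
      finally show ?thesis .
    qed
    obtain I where I: "\<And>e. e \<in> P \<Longrightarrow> ((\<lambda>\<theta>. Y r \<theta> e) has_integral I e) {0..1}"
        "\<And>e. e \<in> P \<Longrightarrow> I e \<le> T (lo e) r * \<delta> e + (T (hi e) r - T (lo e) r)"
      using \<delta>(2)[of _ r] by metis
    have "((\<lambda>\<theta>. (\<Sum>e\<in>P. W e * Y r \<theta> e) / 2) has_integral (\<Sum>e\<in>P. W e * I e) / 2) {0..1}"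
      by (intro has_integral_divide has_integral_sum finite_P has_integral_mult_right I(1))
    moreover have "((\<lambda>_. ?h * vol \<mu> V1) has_integral ?h * vol \<mu> V1) {0..1::real}"
      using has_integral_const_real[of "?h * vol \<mu> V1" 0 1] by simp
    ultimately have "?h * vol \<mu> V1 \<le> (\<Sum>e\<in>P. W e * I e) / 2"
      by (rule has_integral_le[OF _ _ pt, rotated])
    also have "\<dots> \<le> (\<Sum>e\<in>P. W e * (T (lo e) r * \<delta> e + (T (hi e) r - T (lo e) r))) / 2"
      by (intro divide_right_mono sum_mono mult_left_mono I(2)) (auto intro: less_imp_le[OF W])
    finally show ?thesis by (simp add: vol)
  qed
  \<comment> \<open>A common bound for all squared moduli, so that every threshold integral over
    \<open>{0..M}\<close> is complete.\<close>
  define M where "M = (\<Sum>u\<in>V. p u)"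
  have p: "0 \<le> p u" "u \<in> V \<Longrightarrow> p u \<le> M" for u
    by (auto simp: p_def M_def intro!: member_le_sum finite_V)
  have TI: "(T c has_integral c) {0..M}" if "0 \<le> c" "c \<le> M" for c
    unfolding T_def using has_integral_threshold[OF that] .
  have lohi: "(T (lo e) has_integral lo e) {0..M}" "(T (hi e) has_integral hi e) {0..M}" if "e \<in> P" for e
    using edgeD(1,2)[of "fst e" "snd e"] that p
    by (auto intro!: TI simp: lo_def hi_def min_le_iff_disj le_max_iff_disj)
  have "((\<lambda>r. ?h * (\<Sum>u\<in>V. \<mu> u * T (p u) r)) has_integral ?h * (\<Sum>u\<in>V. \<mu> u * p u)) {0..M}"
    by (intro has_integral_mult_right has_integral_sum finite_V TI p)
  moreover have "((\<lambda>r. (\<Sum>e\<in>P. W e * (T (lo e) r * \<delta> e + (T (hi e) r - T (lo e) r))) / 2)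
      has_integral (\<Sum>e\<in>P. W e * (lo e * \<delta> e + (hi e - lo e))) / 2) {0..M}"
    by (intro has_integral_divide has_integral_sum finite_P has_integral_mult_right has_integral_add
        has_integral_diff has_integral_mult_left lohi)
  ultimately have "?h * (\<Sum>u\<in>V. \<mu> u * p u) \<le> (\<Sum>e\<in>P. W e * (lo e * \<delta> e + (hi e - lo e))) / 2"
    by (rule has_integral_le[OF _ _ level])
  \<comment> \<open>The factor 2 from the edge bound cancels the 1/2 that accounts for the two
    orientations.\<close>
  also have "\<dots> \<le> (\<Sum>e\<in>P. W e * (2 * R e)) / 2"
    by (intro divide_right_mono sum_mono mult_left_mono \<delta>(1)) (auto intro: less_imp_le[OF W])
  also have "\<dots> = (\<Sum>e\<in>P. W e * R e)" by (simp add: sum_divide_distrib)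
  finally show ?thesis by (simp add: nrm2_def p_def W_def R_def case_prod_unfold)
qed

section \<open>Degree bound and Cauchy-Schwarz\<close>

text \<open>The constant is \<open>2 * 2\<close>: one factor from
  \<open>(x + y)\<^sup>2 \<le> 2 * x\<^sup>2 + 2 * y\<^sup>2\<close>, the other because both ends of
  the oriented edges yield the same degree sum.\<close>

lemma sum_degree_bound:
  "(\<Sum>(u, v)\<in>P. w u v * (cmod (f u) + cmod (f v))\<^sup>2) \<le> 4 * d_max V E w \<mu> * nrm2 f"
proof -
  have "(\<Sum>(u, v)\<in>P. w u v * (cmod (f u) + cmod (f v))\<^sup>2)
      \<le> (\<Sum>(u, v)\<in>P. 2 * (w u v * (cmod (f u))\<^sup>2) + 2 * (w v u * (cmod (f v))\<^sup>2))"
  proof (rule sum_mono, clarify)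
    fix u v assume uv: "(u, v) \<in> P"
    have "(cmod (f u) + cmod (f v))\<^sup>2 \<le> 2 * (cmod (f u))\<^sup>2 + 2 * (cmod (f v))\<^sup>2"
      using zero_le_power2[of "cmod (f u) - cmod (f v)"] by (simp add: power2_eq_square algebra_simps)
    from mult_left_mono[OF this less_imp_le[OF edgeD(5)[OF uv]]]
    show "w u v * (cmod (f u) + cmod (f v))\<^sup>2
        \<le> 2 * (w u v * (cmod (f u))\<^sup>2) + 2 * (w v u * (cmod (f v))\<^sup>2)"
      by (simp add: edgeD(6)[OF uv] algebra_simps)
  qed
  also have "\<dots> = 2 * (\<Sum>(u, v)\<in>P. w u v * (cmod (f u))\<^sup>2) + 2 * (\<Sum>(u, v)\<in>P. w v u * (cmod (f v))\<^sup>2)"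
    by (simp add: sum.distrib sum_distrib_left case_prod_unfold)
  also have "(\<Sum>(u, v)\<in>P. w v u * (cmod (f v))\<^sup>2) = (\<Sum>(u, v)\<in>P. w u v * (cmod (f u))\<^sup>2)"
    by (rule sum_P_swap)
  also have "(\<Sum>(u, v)\<in>P. w u v * (cmod (f u))\<^sup>2) = (\<Sum>u\<in>V. wdegree E w u * (cmod (f u))\<^sup>2)"
    by (simp add: sum_P[symmetric] wdegree_def sum_distrib_right)
  also have "\<dots> \<le> (\<Sum>u\<in>V. d_max V E w \<mu> * (\<mu> u * (cmod (f u))\<^sup>2))"
  proof (rule sum_mono)
    fix u assume u: "u \<in> V"
    have "wdegree E w u / \<mu> u \<le> d_max V E w \<mu>"
      unfolding d_max_def using u finite_V by (intro Max_ge) auto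
    then have "wdegree E w u \<le> d_max V E w \<mu> * \<mu> u" using mu_pos[OF u] by (simp add: field_simps)
    then show "wdegree E w u * (cmod (f u))\<^sup>2 \<le> d_max V E w \<mu> * (\<mu> u * (cmod (f u))\<^sup>2)"
      unfolding mult.assoc[symmetric] by (rule mult_right_mono) simp
  qed
  also have "\<dots> = d_max V E w \<mu> * nrm2 f" by (simp add: nrm2_def sum_distrib_left)
  finally show ?thesis by (simp add: mult_ac)
qed

text \<open>Apply \<open>cheeger_coarea\<close> to a function attaining the least Rayleigh quotient
  and split each weight as \<open>sqrt (W e) * sqrt (W e)\<close>: Cauchy-Schwarz separates the
  energy from the degree sum.\<close>

lemma cheeger_le_sqrt_lambda1:
  "cheeger1 k V E w \<mu> s \<le> 2 * sqrt (2 * d_max V E w \<mu> * lambda1 V E w \<mu> s)"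
proof -
  let ?h = "cheeger1 k V E w \<mu> s" and ?d = "d_max V E w \<mu>" and ?l = "lambda1 V E w \<mu> s"
  obtain f u0 where u0: "u0 \<in> V" "f u0 \<noteq> 0" and f: "dirichlet f = ?l * nrm2 f"
    using lambda1_eigenfunction by blast
  define N where "N = nrm2 f"
  have N: "N > 0" using nrm2_pos[of u0 f] u0 by (simp add: N_def)
  define D where "D e = cmod (f (fst e) - s e * f (snd e))" for e
  define A where "A e = cmod (f (fst e)) + cmod (f (snd e))" for e
  define W where "W e = w (fst e) (snd e)" for e
  have W: "W e > 0" if "e \<in> P" for e
    using edgeD(5)[of "fst e" "snd e"] that by (simp add: W_def)
  have "(\<Sum>e\<in>P. W e * (D e * A e)) = (\<Sum>e\<in>P. (sqrt (W e) * D e) * (sqrt (W e) * A e))"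
  proof (rule sum.cong[OF refl])
    fix e assume "e \<in> P"
    then have "W e = sqrt (W e) * sqrt (W e)" using W[of e] by simp
    then show "W e * (D e * A e) = (sqrt (W e) * D e) * (sqrt (W e) * A e)" by (simp add: mult_ac)
  qed
  also have "\<dots>\<^sup>2 \<le> (\<Sum>e\<in>P. (sqrt (W e) * D e)\<^sup>2) * (\<Sum>e\<in>P. (sqrt (W e) * A e)\<^sup>2)"
    by (rule Cauchy_Schwarz_ineq_sum)
  also have "(\<Sum>e\<in>P. (sqrt (W e) * D e)\<^sup>2) = 2 * (?l * N)"
  proof -
    have "(\<Sum>e\<in>P. (sqrt (W e) * D e)\<^sup>2) = (\<Sum>e\<in>P. W e * (D e)\<^sup>2)"
      using W by (intro sum.cong) (auto simp: power_mult_distrib less_imp_le)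
    also have "\<dots> = 2 * dirichlet f" by (simp add: dirichlet_def W_def D_def case_prod_unfold)
    finally show ?thesis by (simp add: f N_def)
  qed
  also have "(\<Sum>e\<in>P. (sqrt (W e) * A e)\<^sup>2) = (\<Sum>e\<in>P. W e * (A e)\<^sup>2)"
    using W by (intro sum.cong) (auto simp: power_mult_distrib less_imp_le)
  also have "2 * (?l * N) * (\<Sum>e\<in>P. W e * (A e)\<^sup>2) \<le> 2 * (?l * N) * (4 * ?d * N)"
  proof (rule mult_left_mono)
    show "(\<Sum>e\<in>P. W e * (A e)\<^sup>2) \<le> 4 * ?d * N"
      using sum_degree_bound[of f] by (simp add: W_def A_def N_def case_prod_unfold)
    have "dirichlet f \<ge> 0"
      unfolding dirichlet_def by (auto intro!: sum_nonneg mult_nonneg_nonneg less_imp_le[OF edgeD(5)])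
    then show "0 \<le> 2 * (?l * N)" by (simp add: f N_def)
  qed
  \<comment> \<open>The product of \<open>2 * (?l * N)\<close> and \<open>4 * ?d * N\<close> is
    arranged so that the square root releases \<open>2 * N\<close>; dividing by \<open>N\<close>
    then leaves the stated constant.\<close>
  finally have "(\<Sum>e\<in>P. W e * (D e * A e))\<^sup>2 \<le> (2 * N)\<^sup>2 * (2 * ?d * ?l)"
    by (simp add: power2_eq_square mult_ac)
  then have "(\<Sum>e\<in>P. W e * (D e * A e)) \<le> sqrt ((2 * N)\<^sup>2 * (2 * ?d * ?l))"
    by (rule real_le_rsqrt)
  also have "\<dots> = N * (2 * sqrt (2 * ?d * ?l))"
    unfolding real_sqrt_mult[of "(2 * N)\<^sup>2"] real_sqrt_abs using N by simp
  finally have "N * ?h \<le> N * (2 * sqrt (2 * ?d * ?l))"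
    using cheeger_coarea[of f] by (simp add: N_def W_def D_def A_def case_prod_unfold mult.commute)
  then show ?thesis using N by (rule mult_left_le_imp_le)
qed

end

theorem theorem4p1:
  fixes k :: nat and V :: "'a set" and E :: "'a set set"
    and w :: "'a \<Rightarrow> 'a \<Rightarrow> real" and \<mu> :: "'a \<Rightarrow> real" and s :: "'a \<times> 'a \<Rightarrow> complex"
  assumes "k \<ge> 1"
    and "weighted_graph V E w"
    and "\<forall>u\<in>V. \<mu> u > 0"
    and "signature k E s"
  shows "1/2 * lambda1 V E w \<mu> s \<le> cheeger1 k V E w \<mu> s
    \<and> cheeger1 k V E w \<mu> s \<le> 2 * sqrt (2 * d_max V E w \<mu> * lambda1 V E w \<mu> s)"
proof -
  interpret signed_graph k V E w \<mu> s
    using assms by unfold_locales auto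
  show ?thesis using cheeger_ge_half_lambda1 cheeger_le_sqrt_lambda1 by simp
qed

end
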